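(* Let $D=[0,T]\times\Omega_P$, where $T>0$ and $\Omega_P\subset\mathbb{R}^d$ is a bounded Lipschitz domain, be normalized so that its Lebesgue measure is $|D|=1$, and let $g:D\to[0,\infty)$ be a measurable function of the form $g(y)=|\mathcal{R}(y)|^2$ for $y=(t,\mathbf{x})\in D$. Assume $0<\int_D g^2(y)\,\mathrm{d}y<\infty$ and let $$\tilde\rho(y):=\frac{g^2(y)}{\int_D g^2(y')\,\mathrm{d}y'} .$$ Suppose $\rho$ is a normalized probability density on $D$ (i.e. $\int_D\rho\,\mathrm{d}y=1$) with $\rho(y)>0$ almost everywhere, such that for some measurable function $\tau:D\to[0,1]$, $$\rho(y)=(1-\tau(y))+\tau(y)\,\tilde\rho(y)\quad\text{for a.e. }y\in D .$$ Then $$\int_D\frac{g^2(y)}{\rho(y)}\,\mathrm{d}y\le\int_D g^2(y)\,\mathrm{d}y,$$ and consequently $$\mathrm{Var}_{\rho}\!\left(\frac{g(y)}{\rho(y)}\right)\le\mathrm{Var}_{\rho_u}\big(g(y)\big),$$ where $\rho_u\equiv 1$ is the uniform density on $D$. Moreover, the inequality is strict if the set $\{y\in D: 0<\tau(y)<1,\ \tilde\rho(y)\neq 1\}$ has positive measure.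
   Context: $\mathcal{R}$ denotes a (PDE) residual function on $D$; only the nonnegative measurable function $g=|\mathcal{R}|^2$ enters the statement. For a probability density $\rho$ on $D$ that is positive almost everywhere, $\mathrm{Var}_\rho(h(y))$ denotes the variance of $h(y)$ when $y$ is distributed with density $\rho$; thus $\mathrm{Var}_{\rho}(g/\rho)=\int_D \frac{g^2(y)}{\rho(y)}\,\mathrm{d}y-\left(\int_D g(y)\,\mathrm{d}y\right)^2$ and $\mathrm{Var}_{\rho_u}(g)=\int_D g^2(y)\,\mathrm{d}y-\left(\int_D g(y)\,\mathrm{d}y\right)^2$. *)

theory Defs
  imports "HOL-Probability.Probability"
begin

text \<open>
  The boundary condition is the usual one (up to a rigid change of coordinates): near each boundary
  point the set is the strict epigraph of a Lipschitz function. Coordinate-free, the axis of the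
  epigraph is a unit vector \<open>\<nu>\<close>, the height of \<open>x\<close> is \<open>x \<bullet> \<nu>\<close>, and the remaining coordinates are
  the orthogonal projection \<open>x - (x \<bullet> \<nu>) *\<^sub>R \<nu>\<close> of \<open>x\<close> to the hyperplane \<open>\<nu>\<^sup>\<bottom>\<close>. In dimension 1
  the hyperplane is a point and the condition says that the set is locally a half-line.
\<close>

definition lipschitz_boundary :: "'a::euclidean_space set \<Rightarrow> bool" where
  "lipschitz_boundary \<Omega> \<longleftrightarrow>
     (\<forall>p\<in>frontier \<Omega>. \<exists>\<nu> r L \<phi>. norm \<nu> = 1 \<and> r > 0 \<and> L-lipschitz_on {v. v \<bullet> \<nu> = 0} (\<phi> :: 'a \<Rightarrow> real) \<and>
        \<Omega> \<inter> ball p r = {x \<in> ball p r. \<phi> (x - (x \<bullet> \<nu>) *\<^sub>R \<nu>) < x \<bullet> \<nu>})"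

definition bounded_lipschitz_domain :: "'a::euclidean_space set \<Rightarrow> bool" where
  "bounded_lipschitz_domain \<Omega> \<longleftrightarrow>
     \<Omega> \<noteq> {} \<and> open \<Omega> \<and> connected \<Omega> \<and> bounded \<Omega> \<and> lipschitz_boundary \<Omega>"

definition density_on :: "'a::euclidean_space set \<Rightarrow> ('a \<Rightarrow> real) \<Rightarrow> 'a measure" where
  "density_on D \<rho> = density (lebesgue_on D) (\<lambda>y. ennreal (\<rho> y))"

text \<open>
  The body is the library's \<open>variance\<close> from the locale \<open>prob_space\<close>, for the probability measure
  with density \<open>\<rho>\<close> on \<open>D\<close>. It is a Bochner integral, hence meaningful only for \<open>h\<close> that is
  square-integrable with respect to that measure.
\<close>

definition Var_on :: "'a::euclidean_space set \<Rightarrow> ('a \<Rightarrow> real) \<Rightarrow> ('a \<Rightarrow> real) \<Rightarrow> real" where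
  "Var_on D \<rho> h = prob_space.variance (density_on D \<rho>) h"

definition normalized_square :: "'a::euclidean_space set \<Rightarrow> ('a \<Rightarrow> real) \<Rightarrow> 'a \<Rightarrow> real" where
  "normalized_square D g y = (g y)\<^sup>2 / (\<integral>y'. (g y')\<^sup>2 \<partial>lebesgue_on D)"

end

theory Submission
  imports Defs
begin

text \<open>
  Write \<open>s = g\<^sup>2 / Z\<close> with \<open>Z = \<integral> g\<^sup>2\<close>. Since \<open>\<rho>\<close> is pointwise a convex combination of \<open>1\<close> and \<open>s\<close>,
  the number \<open>\<rho>\<close> lies between \<open>1\<close> and \<open>s\<close>, so \<open>(s - \<rho>) (\<rho> - 1) \<ge> 0\<close>. Dividing by \<open>\<rho> > 0\<close> gives
  \<open>s / \<rho> \<le> s + 1 - \<rho>\<close>, and more exactly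
  \[ s + 1 - \rho - \frac{s}{\rho} = \frac{\tau (1 - \tau) (s - 1)^2}{\rho} \]
  (lemma \<open>convex_combination_gap\<close>). Both \<open>s\<close> and \<open>\<rho>\<close> have integral \<open>1\<close>, as has the constant \<open>1\<close>
  on a domain of measure \<open>1\<close>. Integration therefore yields \<open>\<integral> s / \<rho> \<le> 1\<close>, with equality
  only if the right-hand side vanishes almost everywhere; multiplied by \<open>Z\<close>, this is the claim
  about \<open>\<integral> g\<^sup>2 / \<rho>\<close> (lemma \<open>integral_div_convex_combination\<close>).

  The variance of the importance-sampling estimator \<open>g / \<rho>\<close> is \<open>\<integral> g\<^sup>2 / \<rho> - (\<integral> g)\<^sup>2\<close>
  (lemma \<open>variance_importance_sampling\<close>). Its mean does not depend on \<open>\<rho>\<close>, so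
  variances compare as the second moments do. The uniform density is the case \<open>\<rho> = 1\<close>.
\<close>

lemma convex_combination_gap:
  fixes s t r :: real
  assumes "r = (1 - t) + t * s" and "r \<noteq> 0"
  shows "s + 1 - r - s / r = t * (1 - t) * (s - 1)\<^sup>2 / r"
proof -
  have "(s + 1 - r) * r - s = t * (1 - t) * (s - 1)\<^sup>2"
    unfolding assms(1) by (simp add: power2_eq_square algebra_simps)
  then show ?thesis
    using assms(2) by (simp add: field_simps)
qed

text \<open>
  The gap identity, scaled by the total mass \<open>Z\<close> of \<open>f\<close>, bounds \<open>f / \<rho>\<close> by the integrable function
  \<open>f + Z (1 - \<rho>)\<close>, whose integral is again \<open>Z\<close>.
\<close>

lemma (in prob_space) integral_div_convex_combination:
  fixes f \<rho> \<tau> :: "'a \<Rightarrow> real"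
  defines "Z \<equiv> \<integral>y. f y \<partial>M"
  assumes f: "integrable M f" "\<And>y. y \<in> space M \<Longrightarrow> 0 \<le> f y" "0 < Z"
    and \<rho>: "integrable M \<rho>" "(\<integral>y. \<rho> y \<partial>M) = 1" "AE y in M. 0 < \<rho> y"
    and \<tau>: "\<forall>y\<in>space M. 0 \<le> \<tau> y \<and> \<tau> y \<le> 1"
    and mix: "AE y in M. \<rho> y = (1 - \<tau> y) + \<tau> y * (f y / Z)"
  shows "integrable M (\<lambda>y. f y / \<rho> y)"
    and "(\<integral>y. f y / \<rho> y \<partial>M) \<le> Z"
    and "\<not> (AE y in M. \<not> (0 < \<tau> y \<and> \<tau> y < 1 \<and> f y / Z \<noteq> 1)) \<Longrightarrow> (\<integral>y. f y / \<rho> y \<partial>M) < Z"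
proof -
  note [measurable] = borel_measurable_integrable[OF f(1)] borel_measurable_integrable[OF \<rho>(1)]
  define b where "b y = f y + Z * (1 - \<rho> y)" for y
  have int_b: "integrable M b"
    unfolding b_def using f(1) \<rho>(1) by simp
  have integral_b: "(\<integral>y. b y \<partial>M) = Z"
    unfolding b_def using f(1) \<rho>(1,2) by (simp add: Z_def prob_space)
  have gap: "AE y in M. b y - f y / \<rho> y = Z * (\<tau> y * (1 - \<tau> y) * (f y / Z - 1)\<^sup>2 / \<rho> y)"
    using mix \<rho>(3)
  proof eventually_elim
    case (elim y)
    have "b y - f y / \<rho> y = Z * (f y / Z + 1 - \<rho> y - f y / Z / \<rho> y)"
      using f(3) by (simp add: b_def field_simps)
    also have "\<dots> = Z * (\<tau> y * (1 - \<tau> y) * (f y / Z - 1)\<^sup>2 / \<rho> y)"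
      using convex_combination_gap[of "\<rho> y" "\<tau> y" "f y / Z"] elim by simp
    finally show ?case .
  qed
  have bound: "AE y in M. f y / \<rho> y \<le> b y"
    using gap \<rho>(3) AE_space
  proof eventually_elim
    case (elim y)
    have "0 \<le> Z * (\<tau> y * (1 - \<tau> y) * (f y / Z - 1)\<^sup>2 / \<rho> y)"
      using elim f(3) \<tau> by simp
    then show ?case using elim by simp
  qed
  show int_quot: "integrable M (\<lambda>y. f y / \<rho> y)"
  proof (rule Bochner_Integration.integrable_bound[OF int_b])
    show "AE y in M. norm (f y / \<rho> y) \<le> norm (b y)"
      using bound \<rho>(3) AE_space
    proof eventually_elim
      case (elim y)
      then have "0 \<le> f y / \<rho> y" using f(2)[of y] by simp
      then show ?case using elim(1) by simp
    qed
  qed measurable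
  show le: "(\<integral>y. f y / \<rho> y \<partial>M) \<le> Z"
    using integral_mono_AE[OF int_quot int_b bound] integral_b by simp
  show "(\<integral>y. f y / \<rho> y \<partial>M) < Z"
    if "\<not> (AE y in M. \<not> (0 < \<tau> y \<and> \<tau> y < 1 \<and> f y / Z \<noteq> 1))"
  proof (rule ccontr)
    assume "\<not> ?thesis"
    then have "(\<integral>y. b y - f y / \<rho> y \<partial>M) = 0"
      using le int_b int_quot integral_b by simp
    \<comment> \<open>A nonnegative gap with integral \<open>0\<close> vanishes almost everywhere, so one of its factors does.\<close>
    moreover have "AE y in M. 0 \<le> b y - f y / \<rho> y"
      using bound by simp
    ultimately have "AE y in M. b y - f y / \<rho> y = 0"
      using integral_nonneg_eq_0_iff_AE[of M "\<lambda>y. b y - f y / \<rho> y"] int_b int_quot by simp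
    then have "AE y in M. \<not> (0 < \<tau> y \<and> \<tau> y < 1 \<and> f y / Z \<noteq> 1)"
      using gap \<rho>(3)
    proof eventually_elim
      case (elim y)
      then have "Z * (\<tau> y * (1 - \<tau> y) * (f y / Z - 1)\<^sup>2 / \<rho> y) = 0" by simp
      then show ?case using elim(3) f(3) by auto
    qed
    with that show False by blast
  qed
qed

text \<open>
  Under the density \<open>\<rho>\<close> the weight \<open>1 / \<rho>\<close> cancels in the mean of \<open>g / \<rho>\<close> and cancels one of the
  two factors in its second moment. Square integrability of \<open>g / \<rho>\<close> with respect to a
  probability measure supplies the integrability needed for the mean.
\<close>

lemma variance_importance_sampling:
  fixes g \<rho> :: "'a \<Rightarrow> real"
  assumes meas: "g \<in> borel_measurable M"
    and \<rho>: "integrable M \<rho>" "(\<integral>y. \<rho> y \<partial>M) = 1" "AE y in M. 0 < \<rho> y"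
    and int: "integrable M (\<lambda>y. (g y)\<^sup>2 / \<rho> y)"
  defines "N \<equiv> density M (\<lambda>y. ennreal (\<rho> y))"
  shows "integrable N (\<lambda>y. (g y / \<rho> y)\<^sup>2)"
    and "prob_space.variance N (\<lambda>y. g y / \<rho> y) = (\<integral>y. (g y)\<^sup>2 / \<rho> y \<partial>M) - (\<integral>y. g y \<partial>M)\<^sup>2"
proof -
  note [measurable] = meas borel_measurable_integrable[OF \<rho>(1)]
  have nonneg: "AE y in M. 0 \<le> \<rho> y"
    using \<rho>(3) by eventually_elim simp
  have "emeasure N (space N) = 1"
    using nn_integral_eq_integral[OF \<rho>(1) nonneg] \<rho>(2)
    by (simp add: N_def emeasure_density)
  then interpret N: prob_space N by (rule prob_spaceI)
  have square: "AE y in M. \<rho> y *\<^sub>R (g y / \<rho> y)\<^sup>2 = (g y)\<^sup>2 / \<rho> y"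
    using \<rho>(3) by eventually_elim (simp add: power2_eq_square)
  have lin: "AE y in M. \<rho> y *\<^sub>R (g y / \<rho> y) = g y"
    using \<rho>(3) by eventually_elim simp
  show int2: "integrable N (\<lambda>y. (g y / \<rho> y)\<^sup>2)"
    unfolding N_def
    using int integrable_cong_AE[OF _ _ square] by (subst integrable_density) (auto simp: nonneg)
  have int1: "integrable N (\<lambda>y. g y / \<rho> y)"
    by (rule N.square_integrable_imp_integrable[OF _ int2]) (simp add: N_def)
  have "(\<integral>y. (g y / \<rho> y)\<^sup>2 \<partial>N) = (\<integral>y. (g y)\<^sup>2 / \<rho> y \<partial>M)"
    unfolding N_def
    using integral_cong_AE[OF _ _ square] by (subst integral_density) (auto simp: nonneg)
  moreover have "(\<integral>y. g y / \<rho> y \<partial>N) = (\<integral>y. g y \<partial>M)"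
    unfolding N_def
    using integral_cong_AE[OF _ _ lin] by (subst integral_density) (auto simp: nonneg)
  ultimately show "N.variance (\<lambda>y. g y / \<rho> y) = (\<integral>y. (g y)\<^sup>2 / \<rho> y \<partial>M) - (\<integral>y. g y \<partial>M)\<^sup>2"
    using N.variance_eq[OF int1 int2] by simp
qed

theorem theorem4p2:
  fixes T :: real
    and \<Omega> :: "(real ^ 'd) set"
    and D :: "(real \<times> (real ^ 'd)) set"
    and R :: "real \<times> (real ^ 'd) \<Rightarrow> 'v::real_normed_vector"
    and g \<rho> \<tau> :: "real \<times> (real ^ 'd) \<Rightarrow> real"
  assumes "T > 0"
    and "bounded_lipschitz_domain \<Omega>"
    and "D = {0..T} \<times> \<Omega>"
    and "emeasure lebesgue D = 1"
    and "g \<in> borel_measurable (lebesgue_on D)"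
    and "\<forall>y\<in>D. g y = (norm (R y))\<^sup>2"
    and "integrable (lebesgue_on D) (\<lambda>y. (g y)\<^sup>2)"
    and "0 < (\<integral>y. (g y)\<^sup>2 \<partial>lebesgue_on D)"
    and "\<rho> \<in> borel_measurable (lebesgue_on D)"
    and "integrable (lebesgue_on D) \<rho>"
    and "(\<integral>y. \<rho> y \<partial>lebesgue_on D) = 1"
    and "AE y in lebesgue_on D. \<rho> y > 0"
    and "\<tau> \<in> borel_measurable (lebesgue_on D)"
    and "\<forall>y\<in>D. 0 \<le> \<tau> y \<and> \<tau> y \<le> 1"
    and "AE y in lebesgue_on D. \<rho> y = (1 - \<tau> y) + \<tau> y * normalized_square D g y"
  shows "integrable (lebesgue_on D) (\<lambda>y. (g y)\<^sup>2 / \<rho> y) \<and>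
         (\<integral>y. (g y)\<^sup>2 / \<rho> y \<partial>lebesgue_on D) \<le> (\<integral>y. (g y)\<^sup>2 \<partial>lebesgue_on D) \<and>
         integrable (density_on D \<rho>) (\<lambda>y. (g y / \<rho> y)\<^sup>2) \<and>
         Var_on D \<rho> (\<lambda>y. g y / \<rho> y) \<le> Var_on D (\<lambda>_. 1) g \<and>
         (emeasure lebesgue {y \<in> D. 0 < \<tau> y \<and> \<tau> y < 1 \<and> normalized_square D g y \<noteq> 1} > 0 \<longrightarrow>
            (\<integral>y. (g y)\<^sup>2 / \<rho> y \<partial>lebesgue_on D) < (\<integral>y. (g y)\<^sup>2 \<partial>lebesgue_on D) \<and>
            Var_on D \<rho> (\<lambda>y. g y / \<rho> y) < Var_on D (\<lambda>_. 1) g)"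
proof -
  let ?M = "lebesgue_on D"
  let ?S = "{y \<in> D. 0 < \<tau> y \<and> \<tau> y < 1 \<and> normalized_square D g y \<noteq> 1}"
  \<comment> \<open>\<open>emeasure\<close> is \<open>0\<close> by convention on nonmeasurable sets, so a positive value implies
    measurability, here and for \<open>?S\<close> below.\<close>
  have D: "D \<in> sets lebesgue"
    using assms(4) emeasure_notin_sets[of D lebesgue] by fastforce
  have "emeasure ?M (space ?M) = 1"
    using D assms(4) by (simp add: emeasure_restrict_space)
  then interpret prob_space ?M
    by (rule prob_spaceI)
  have mix: "AE y in ?M. \<rho> y = (1 - \<tau> y) + \<tau> y * ((g y)\<^sup>2 / (\<integral>y'. (g y')\<^sup>2 \<partial>?M))"
    using assms(15) by (simp add: normalized_square_def)
  have \<tau>: "\<forall>y\<in>space ?M. 0 \<le> \<tau> y \<and> \<tau> y \<le> 1"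
    using assms(14) by simp
  note moment = integral_div_convex_combination
      [OF assms(7) zero_le_power2 assms(8) assms(10-12) \<tau> mix]
  note var_\<rho> = variance_importance_sampling[OF assms(5) assms(10-12) moment(1)]
  have Var_\<rho>: "Var_on D \<rho> (\<lambda>y. g y / \<rho> y) = (\<integral>y. (g y)\<^sup>2 / \<rho> y \<partial>?M) - (\<integral>y. g y \<partial>?M)\<^sup>2"
    unfolding Var_on_def density_on_def by (rule var_\<rho>(2))
  have Var_1: "Var_on D (\<lambda>_. 1) g = (\<integral>y. (g y)\<^sup>2 \<partial>?M) - (\<integral>y. g y \<partial>?M)\<^sup>2"
    unfolding Var_on_def density_on_def
    using variance_importance_sampling(2)[of g ?M "\<lambda>_. 1"] assms(5,7) prob_space by simp
  have strict: "(\<integral>y. (g y)\<^sup>2 / \<rho> y \<partial>?M) < (\<integral>y. (g y)\<^sup>2 \<partial>?M)" if pos: "emeasure lebesgue ?S > 0"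
  proof (rule moment(3), rule notI)
    assume "AE y in ?M. \<not> (0 < \<tau> y \<and> \<tau> y < 1 \<and> (g y)\<^sup>2 / (\<integral>y'. (g y')\<^sup>2 \<partial>?M) \<noteq> 1)"
    then have "AE y in lebesgue. y \<in> D \<longrightarrow>
        \<not> (0 < \<tau> y \<and> \<tau> y < 1 \<and> normalized_square D g y \<noteq> 1)"
      using D by (simp add: AE_restrict_space_iff normalized_square_def)
    then have "AE y in lebesgue. y \<notin> ?S"
      by eventually_elim simp
    moreover have "?S \<in> sets lebesgue"
      using pos emeasure_notin_sets[of ?S lebesgue] by fastforce
    ultimately have "emeasure lebesgue ?S = 0"
      using AE_iff_null_sets by blast
    with pos show False by simp
  qed
  show ?thesis
    using moment(1,2) var_\<rho>(1) strict by (simp add: Var_\<rho> Var_1 density_on_def)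
qed

end
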